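(* Let $K,N,M\ge 1$ be integers and let $\Delta_K=\{p\in[0,1]^K:\sum_{y=1}^K p_y=1\}$. Let $(x_1,y_1),\dots,(x_N,y_N)$ be labeled samples with one-hot labels $y_i\in\{0,1\}^K$, and let $x_1^u,\dots,x_M^u$ be unlabeled samples. For each $j=1,\dots,M$ let $P(\cdot\mid x_j^u;\theta',\pi')\in\Delta_K$ be the soft pseudo-label of $x_j^u$ computed from fixed previous-iteration parameters $(\theta',\pi')$. Let $\mathcal{Q}(\theta,\pi;\theta',\pi')$, with $\pi=(\pi_l,\pi_u)\in\Delta_K\times\Delta_K$, be the expected complete-data log-likelihood defined in the context. Then for every fixed $\theta$, the optimal $\hat\pi=(\hat\pi_l,\hat\pi_u)$ that maximizes $\mathcal{Q}(\theta,\pi;\theta',\pi')$ over $\pi\in\Delta_K\times\Delta_K$ is $$\hat\pi_l=\frac1N\sum_{i=1}^N y_i,\qquad \hat\pi_u=\frac1M\sum_{j=1}^M P(\cdot\mid x_j^u;\theta',\pi'),$$ that is, for each class $k$, $(\hat\pi_l)_k=\frac1N\sum_{i=1}^N (y_i)_k$ and $(\hat\pi_u)_k=\frac1M\sum_{j=1}^M P(k\mid x_j^u;\theta',\pi')$.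
   Context: Setting: semi-supervised classification into $K$ classes. The labeled and unlabeled data share the class-conditional distribution $P(x\mid y)$ but may have different class distributions, $\pi_l$ (labeled) and $\pi_u$ (unlabeled). For $p\in\Delta_K$, $P(y;p)=p_y$ denotes the categorical distribution. A one-hot label $y_i$ is identified with the index of its nonzero entry when used as a class. Expected complete-data log-likelihood (terms not depending on $(\theta,\pi)$ dropped): $$\mathcal{Q}(\theta,\pi;\theta',\pi')=\sum_{i=1}^N\log P(y_i\mid x_i;\theta,\pi_l)+\sum_{j=1}^M\sum_{y=1}^K P(y\mid x_j^u;\theta',\pi')\,\log P(y\mid x_j^u;\theta,\pi_u).$$ Parametrization: $P(y\mid x;\theta,\pi)=P(y;\pi)\,g(x,y;\theta)$, where $g(x,y;\theta)>0$ (representing the ratio $P(x\mid y)/P(x)$) depends only on $\theta$ and not on $\pi$. The only constraints on $\pi_l,\pi_u$ are that they lie in $\Delta_K$. Hence the terms of $\mathcal{Q}$ that involve $\pi$ are $$\sum_{i=1}^N\log P(y_i;\pi_l)+\sum_{j=1}^M\sum_{y=1}^K P(y\mid x_j^u;\theta',\pi')\log P(y;\pi_u).$$ Conventions: $\log 0=-\infty$ and $0\cdot\log 0=0$. *)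

theory Defs
  imports "HOL-Analysis.Analysis"
begin

text \<open>
  Classes are the elements of a finite type \<open>'k\<close>, so $K = \<open>CARD('k)\<close> \ge 1$, and vectors
  in $R^K$ are of type \<open>real ^ 'k\<close>.
\<close>

definition prob_simplex :: "(real ^ 'k) set"  where
  "prob_simplex = {p. (\<forall>k. p $ k \<in> {0..1}) \<and> (\<Sum>k\<in>UNIV. p $ k) = 1}"

definition one_hot :: "real ^ 'k \<Rightarrow> bool" where
  "one_hot v \<longleftrightarrow> (\<forall>k. v $ k \<in> {0, 1}) \<and> (\<exists>!k. v $ k \<noteq> 0)"

definition label_class :: "real ^ 'k \<Rightarrow> 'k" where
  "label_class v = (THE k. v $ k \<noteq> 0)"

text \<open>
  The logarithm of a nonnegative real with $\log 0 = -\infty$; the convention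
  $0 \cdot \log 0 = 0$ is then that of multiplication on \<^typ>\<open>ereal\<close>.
\<close>

definition elog :: "real \<Rightarrow> ereal" where
  "elog r = (if r = 0 then -\<infinity> else ereal (ln r))"

definition categorical :: "real ^ 'k \<Rightarrow> 'k \<Rightarrow> real" where
  "categorical p y = p $ y"

text \<open>
  $P(y \mid x; \theta, p) = P(y; p)\, g(x, y; \theta)$. Since \<open>g\<close> does not depend on \<open>p\<close>, this
  is not required to sum to 1 over \<open>y\<close> for every \<open>p\<close>.
\<close>

definition class_posterior ::
  "('x \<Rightarrow> 'k \<Rightarrow> 't \<Rightarrow> real) \<Rightarrow> 't \<Rightarrow> real ^ 'k \<Rightarrow> 'x \<Rightarrow> 'k \<Rightarrow> real" where
  "class_posterior g \<theta> p x y = categorical p y * g x y \<theta>"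

text \<open>
  The expected complete-data log-likelihood $Q(\theta,\pi;\theta',\pi')$. A prior
  \<open>\<pi> = (\<pi>\<^sub>l, \<pi>\<^sub>u)\<close> is a pair. The vector \<open>S \<theta>' \<pi>' x\<close> is the soft pseudo-label
  $P(\cdot \mid x; \theta', \pi')$. The map \<open>S\<close> is arbitrary; in particular, it may be given by
  \<open>S \<theta>' \<pi>' x $ y = class_posterior g \<theta>' (snd \<pi>') x y\<close>.
\<close>

definition expected_loglik ::
  "('x \<Rightarrow> 'k::finite \<Rightarrow> 't \<Rightarrow> real) \<Rightarrow>
   ('t \<Rightarrow> (real ^ 'k) \<times> (real ^ 'k) \<Rightarrow> 'x \<Rightarrow> real ^ 'k) \<Rightarrow>
   nat \<Rightarrow> (nat \<Rightarrow> 'x) \<Rightarrow> (nat \<Rightarrow> real ^ 'k) \<Rightarrow> nat \<Rightarrow> (nat \<Rightarrow> 'x) \<Rightarrow>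
   't \<Rightarrow> (real ^ 'k) \<times> (real ^ 'k) \<Rightarrow> 't \<Rightarrow> (real ^ 'k) \<times> (real ^ 'k) \<Rightarrow> ereal" where
  "expected_loglik g S N x y M xu \<theta> \<pi> \<theta>' \<pi>' =
     (\<Sum>i=1..N. elog (class_posterior g \<theta> (fst \<pi>) (x i) (label_class (y i)))) +
     (\<Sum>j=1..M. \<Sum>k\<in>UNIV.
        ereal (S \<theta>' \<pi>' (xu j) $ k) * elog (class_posterior g \<theta> (snd \<pi>) (xu j) k))"

end

theory Submission
  imports Defs
begin

text \<open>
  A one-hot label is a degenerate soft label, so both summands of the log-likelihood are soft
  log-likelihoods. Up to a positive factor and an additive constant, such a function of \<open>p\<close> is
  the negated cross entropy of \<open>p\<close> relative to the average soft label \<open>m\<close>, which by Gibbs'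
  inequality is maximal exactly at \<open>p = m\<close>; it is \<open>-\<infinity>\<close> as soon as \<open>p\<close> vanishes somewhere on
  the support of \<open>m\<close>.
\<close>

definition soft_loglik ::
  "nat \<Rightarrow> (nat \<Rightarrow> real ^ 'k) \<Rightarrow> (nat \<Rightarrow> 'k \<Rightarrow> real) \<Rightarrow> real ^ 'k::finite \<Rightarrow> ereal" where
  "soft_loglik n s c p = (\<Sum>j=1..n. \<Sum>k\<in>UNIV. ereal (s j $ k) * elog (p $ k * c j k))"

lemma prob_simplex_nonneg: "p \<in> prob_simplex \<Longrightarrow> 0 \<le> p $ k"
  by (simp add: prob_simplex_def)

lemma prob_simplex_sum: "p \<in> prob_simplex \<Longrightarrow> (\<Sum>k\<in>UNIV. p $ k) = 1"
  by (simp add: prob_simplex_def)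

text \<open>The upper bound 1 comes for free: a nonnegative entry is at most the sum of all
  entries.\<close>

lemma prob_simplexI:
  fixes p :: "real ^ 'k::finite"
  assumes "\<And>k. 0 \<le> p $ k" "(\<Sum>k\<in>UNIV. p $ k) = 1"
  shows "p \<in> prob_simplex"
proof -
  have "p $ k \<le> 1" for k
    using assms member_le_sum[of k UNIV "\<lambda>k. p $ k"] by simp
  then show ?thesis
    using assms by (simp add: prob_simplex_def)
qed

lemma mean_in_prob_simplex:
  fixes s :: "nat \<Rightarrow> real ^ 'k::finite"
  assumes "n \<ge> 1" and s: "\<And>j. j \<in> {1..n} \<Longrightarrow> s j \<in> prob_simplex"
  shows "(1 / real n) *\<^sub>R (\<Sum>j=1..n. s j) \<in> prob_simplex"
proof (rule prob_simplexI)
  show "0 \<le> ((1 / real n) *\<^sub>R (\<Sum>j=1..n. s j)) $ k" for k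
    using s by (auto intro!: sum_nonneg divide_nonneg_nonneg prob_simplex_nonneg)
  have "(\<Sum>k\<in>UNIV. (\<Sum>j=1..n. s j) $ k) = (\<Sum>j=1..n. \<Sum>k\<in>UNIV. s j $ k)"
    by (simp add: sum.swap[of _ UNIV])
  also have "\<dots> = real n"
    using s by (simp add: prob_simplex_sum)
  finally show "(\<Sum>k\<in>UNIV. ((1 / real n) *\<^sub>R (\<Sum>j=1..n. s j)) $ k) = 1"
    using assms(1) by (simp flip: sum_divide_distrib del: sum_component)
qed

lemma one_hot_nth:
  assumes "one_hot v"
  shows "v $ k = (if k = label_class v then 1 else 0)"
proof -
  have "v $ label_class v \<noteq> 0"
    unfolding label_class_def by (rule theI') (use assms in \<open>simp add: one_hot_def\<close>)
  then show ?thesis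
    using assms unfolding one_hot_def by (metis insertE singletonD)
qed

lemma one_hot_in_prob_simplex:
  fixes v :: "real ^ 'k::finite"
  assumes "one_hot v"
  shows "v \<in> prob_simplex"
  by (rule prob_simplexI) (simp_all add: one_hot_nth[OF assms])

text \<open>In \<open>ereal\<close>, zero times \<infinity> or -\<infinity> is 0, so the zero
  entries contribute nothing even where \<open>f\<close> is infinite. This gives a hard label the
  form of a soft one.\<close>

lemma one_hot_sum_mult:
  fixes v :: "real ^ 'k::finite" and f :: "'k \<Rightarrow> ereal"
  assumes "one_hot v"
  shows "(\<Sum>k\<in>UNIV. ereal (v $ k) * f k) = f (label_class v)"
proof -
  have "(\<Sum>k\<in>UNIV. ereal (v $ k) * f k) = (\<Sum>k\<in>UNIV. if k = label_class v then f k else 0)"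
    by (rule sum.cong) (simp_all add: one_hot_nth[OF assms] zero_ereal_def[symmetric] one_ereal_def[symmetric])
  then show ?thesis by simp
qed

text \<open>The bound \<open>ln r \<le> r - 1\<close>, with equality only at \<open>r = 1\<close>,
  is applied to \<open>r = p $ k / m $ k\<close> and weighted by \<open>m $ k\<close>. Under the
  support condition the real \<open>ln\<close> is harmless: wherever \<open>p $ k = 0\<close>, its
  weight is 0.\<close>

lemma gibbs_inequality_strict:
  fixes m p :: "real ^ 'k::finite"
  assumes m: "m \<in> prob_simplex" and p: "p \<in> prob_simplex"
    and supp: "\<And>k. m $ k \<noteq> 0 \<Longrightarrow> p $ k \<noteq> 0" and "p \<noteq> m"
  shows "(\<Sum>k\<in>UNIV. m $ k * ln (p $ k)) < (\<Sum>k\<in>UNIV. m $ k * ln (m $ k))"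
proof -
  \<comment> \<open>The added \<open>p $ k - m $ k\<close> sums to 0 over the classes, as both
    vectors have total mass 1, but makes every single \<open>d k\<close> nonnegative.\<close>
  define d where "d k = p $ k - m $ k - (m $ k * ln (p $ k) - m $ k * ln (m $ k))" for k
  have d: "0 \<le> d k \<and> (d k = 0 \<longrightarrow> p $ k = m $ k)" for k
  proof (cases "m $ k = 0")
    case True
    then show ?thesis using prob_simplex_nonneg[OF p, of k] by (simp add: d_def)
  next
    case False
    then have pos: "0 < m $ k" "0 < p $ k"
      using supp[of k] prob_simplex_nonneg[OF m, of k] prob_simplex_nonneg[OF p, of k] by auto
    define r where "r = p $ k / m $ k"
    have "0 < r" using pos by (simp add: r_def)
    have "d k = m $ k * (r - 1 - ln r)"
      using pos by (simp add: d_def r_def ln_div algebra_simps)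
    then show ?thesis
      using pos ln_le_minus_one[OF \<open>0 < r\<close>] ln_eq_minus_one[OF \<open>0 < r\<close>] by (auto simp: r_def)
  qed
  obtain k where "p $ k \<noteq> m $ k"
    using \<open>p \<noteq> m\<close> by (auto simp: vec_eq_iff)
  then have "0 < d k" using d[of k] by auto
  then have "0 < (\<Sum>k\<in>UNIV. d k)"
    using d by (intro sum_pos2[of _ k]) auto
  then show ?thesis
    by (simp add: d_def sum_subtractf prob_simplex_sum[OF m] prob_simplex_sum[OF p])
qed

text \<open>Since \<infinity> absorbs -\<infinity> in \<open>ereal\<close> addition, a summand
  -\<infinity> decides the sum only when no summand is \<infinity>.\<close>

lemma sum_ereal_eq_MInfty:
  fixes f :: "'a \<Rightarrow> ereal"
  assumes "finite A" "a \<in> A" "f a = -\<infinity>" "\<And>x. x \<in> A \<Longrightarrow> f x \<noteq> \<infinity>"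
  shows "sum f A = -\<infinity>"
proof -
  have "sum f (A - {a}) \<noteq> \<infinity>"
    using assms by (auto simp: sum_Pinfty)
  then show ?thesis
    using assms by (subst sum.remove[of A a]) auto
qed

lemma soft_loglik_infinite:
  assumes s: "\<And>j. j \<in> {1..n} \<Longrightarrow> s j \<in> prob_simplex"
    and k: "(\<Sum>j=1..n. s j) $ k \<noteq> 0" "p $ k = 0"
  shows "soft_loglik n s c p = -\<infinity>"
proof -
  \<comment> \<open>The weights are nonnegative and \<open>elog\<close> never takes the value
    \<infinity>.\<close>
  have le: "ereal (s j $ i) * elog (p $ i * c j i) \<noteq> \<infinity>" if "j \<in> {1..n}" for i j
    using prob_simplex_nonneg[OF s[OF that], of i] by (auto simp: elog_def)
  obtain j where j: "j \<in> {1..n}" "s j $ k \<noteq> 0"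
    using k(1) unfolding sum_component by (rule sum.not_neutral_contains_not_neutral)
  have "(\<Sum>i\<in>UNIV. ereal (s j $ i) * elog (p $ i * c j i)) = -\<infinity>"
    using j k prob_simplex_nonneg[OF s[OF j(1)], of k] le[OF j(1)]
    by (intro sum_ereal_eq_MInfty[of _ k]) (auto simp: elog_def)
  then show ?thesis
    unfolding soft_loglik_def using j(1) le by (intro sum_ereal_eq_MInfty[of _ j]) (auto simp: sum_Pinfty)
qed

text \<open>Positivity of \<open>c\<close> lets the logarithm of the product split; the part with
  \<open>c\<close> is constant in \<open>p\<close>, and swapping the sums collects the total weight
  of each \<open>ln (p $ k)\<close>.\<close>

lemma soft_loglik_finite:
  assumes s: "\<And>j. j \<in> {1..n} \<Longrightarrow> s j \<in> prob_simplex"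
    and c: "\<And>j k. 0 < c j k" and p: "p \<in> prob_simplex"
    and supp: "\<And>k. (\<Sum>j=1..n. s j) $ k \<noteq> 0 \<Longrightarrow> p $ k \<noteq> 0"
  shows "soft_loglik n s c p = ereal ((\<Sum>j=1..n. \<Sum>k\<in>UNIV. s j $ k * ln (c j k)) +
           (\<Sum>k\<in>UNIV. (\<Sum>j=1..n. s j) $ k * ln (p $ k)))"
proof -
  have term_eq: "ereal (s j $ k) * elog (p $ k * c j k) = ereal (s j $ k * ln (c j k) + s j $ k * ln (p $ k))"
    if j: "j \<in> {1..n}" for j k
  proof (cases "s j $ k = 0")
    case True
    then show ?thesis by (simp flip: zero_ereal_def)
  next
    case False
    \<comment> \<open>Nonnegative weights cannot cancel, so one nonzero weight puts \<open>k\<close>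
      in the support of the sum.\<close>
    then have "(\<Sum>i=1..n. s i $ k) \<noteq> 0"
      using j s by (subst sum_nonneg_eq_0_iff) (auto simp: prob_simplex_nonneg)
    then have "0 < p $ k"
      using supp[of k] prob_simplex_nonneg[OF p, of k] by simp
    then show ?thesis
      using c[of j k] by (simp add: elog_def ln_mult algebra_simps)
  qed
  have "soft_loglik n s c p = ereal (\<Sum>j=1..n. \<Sum>k\<in>UNIV. s j $ k * ln (c j k) + s j $ k * ln (p $ k))"
    by (simp add: soft_loglik_def term_eq)
  moreover have "(\<Sum>j=1..n. \<Sum>k\<in>UNIV. s j $ k * ln (p $ k)) = (\<Sum>k\<in>UNIV. (\<Sum>j=1..n. s j) $ k * ln (p $ k))"
    by (subst sum.swap) (simp add: sum_distrib_right)
  ultimately show ?thesis by (simp add: sum.distrib)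
qed

text \<open>Finiteness at the mean is recorded separately because a strict inequality in
  \<open>ereal\<close> survives addition only if the other summand does not absorb it.\<close>

lemma soft_loglik_mean:
  fixes s :: "nat \<Rightarrow> real ^ 'k::finite"
  defines "m n \<equiv> (1 / real n) *\<^sub>R (\<Sum>j=1..n. s j)"
  assumes n: "n \<ge> 1" and s: "\<And>j. j \<in> {1..n} \<Longrightarrow> s j \<in> prob_simplex"
    and c: "\<And>j k. 0 < c j k"
  shows soft_loglik_mean_finite: "\<bar>soft_loglik n s c (m n)\<bar> \<noteq> \<infinity>"
    and soft_loglik_less_mean:
      "\<And>p. p \<in> prob_simplex \<Longrightarrow> p \<noteq> m n \<Longrightarrow> soft_loglik n s c p < soft_loglik n s c (m n)"
proof -
  have m: "m n \<in> prob_simplex"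
    unfolding m_def using n s by (rule mean_in_prob_simplex)
  have sum_eq: "(\<Sum>j=1..n. s j) $ k = real n * m n $ k" for k
    using n by (simp add: m_def)
  define C where "C = (\<Sum>j=1..n. \<Sum>k\<in>UNIV. s j $ k * ln (c j k))"
  have fin: "soft_loglik n s c p = ereal (C + real n * (\<Sum>k\<in>UNIV. m n $ k * ln (p $ k)))"
    if "p \<in> prob_simplex" "\<And>k. m n $ k \<noteq> 0 \<Longrightarrow> p $ k \<noteq> 0" for p
  proof -
    have "p $ k \<noteq> 0" if "(\<Sum>j=1..n. s j) $ k \<noteq> 0" for k
      using \<open>m n $ k \<noteq> 0 \<Longrightarrow> p $ k \<noteq> 0\<close> that n unfolding sum_eq by simp
    then show ?thesis
      using soft_loglik_finite[of n s c p] s c \<open>p \<in> prob_simplex\<close>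
      unfolding sum_eq C_def by (simp add: mult.assoc sum_distrib_left)
  qed
  \<comment> \<open>The remaining support premise is trivial for \<open>m n\<close> itself, so the
    value at the mean is finite.\<close>
  note fin_m = fin[OF m]
  show "\<bar>soft_loglik n s c (m n)\<bar> \<noteq> \<infinity>"
    using fin_m by simp
  fix p :: "real ^ 'k"
  assume p: "p \<in> prob_simplex" and "p \<noteq> m n"
  show "soft_loglik n s c p < soft_loglik n s c (m n)"
  proof (cases "\<exists>k. m n $ k \<noteq> 0 \<and> p $ k = 0")
    case True
    then obtain k where "(\<Sum>j=1..n. s j) $ k \<noteq> 0" "p $ k = 0"
      using n unfolding sum_eq by auto
    then have "soft_loglik n s c p = -\<infinity>"
      using soft_loglik_infinite[of n s] s by blast
    then show ?thesis using fin_m by simp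
  next
    case False
    then have supp: "\<And>k. m n $ k \<noteq> 0 \<Longrightarrow> p $ k \<noteq> 0" by blast
    have "(\<Sum>k\<in>UNIV. m n $ k * ln (p $ k)) < (\<Sum>k\<in>UNIV. m n $ k * ln (m n $ k))"
      using m p supp \<open>p \<noteq> m n\<close> by (rule gibbs_inequality_strict)
    then show ?thesis
      using n fin_m fin[OF p supp] by simp
  qed
qed

text \<open>The objective separates, so the coordinates can be maximized independently. A pair other
  than \<open>(a, b)\<close> loses strictly in one coordinate and gains in neither; finiteness of
  \<open>f a\<close> and \<open>h b\<close> keeps the loss strict in the sum, even if
  \<open>f p\<close> or \<open>h q\<close> is -\<infinity>.\<close>

lemma is_arg_max_add_ereal:
  fixes f :: "'a \<Rightarrow> ereal" and h :: "'b \<Rightarrow> ereal"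
  assumes a: "a \<in> A" "\<bar>f a\<bar> \<noteq> \<infinity>" "\<And>p. p \<in> A \<Longrightarrow> p \<noteq> a \<Longrightarrow> f p < f a"
    and b: "b \<in> B" "\<bar>h b\<bar> \<noteq> \<infinity>" "\<And>q. q \<in> B \<Longrightarrow> q \<noteq> b \<Longrightarrow> h q < h b"
  shows "is_arg_max (\<lambda>z. f (fst z) + h (snd z)) (\<lambda>z. z \<in> A \<times> B) w \<longleftrightarrow> w = (a, b)"
proof -
  have less: "f p + h q < f a + h b" if "p \<in> A" "q \<in> B" "(p, q) \<noteq> (a, b)" for p q
  proof (cases "p = a")
    case True
    then show ?thesis
      using that a(2) b(3)[of q] by (cases "f a"; cases "h q"; cases "h b") auto
  next
    case False
    moreover have "h q \<le> h b" using b(3)[of q] that by force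
    ultimately show ?thesis
      using that a(2) a(3)[of p] b(2) by (cases "f p"; cases "f a"; cases "h q"; cases "h b") auto
  qed
  show ?thesis
  proof
    assume max: "is_arg_max (\<lambda>z. f (fst z) + h (snd z)) (\<lambda>z. z \<in> A \<times> B) w"
    show "w = (a, b)"
    proof (rule ccontr)
      assume "w \<noteq> (a, b)"
      then have "f (fst w) + h (snd w) < f a + h b"
        using max less[of "fst w" "snd w"] by (auto simp: is_arg_max_def)
      then show False
        using max a(1) b(1) by (auto simp: is_arg_max_def)
    qed
  next
    assume "w = (a, b)"
    moreover have "\<not> f a + h b < f p + h q" if "p \<in> A" "q \<in> B" for p q
      using less[OF that] by (cases "(p, q) = (a, b)") auto
    ultimately show "is_arg_max (\<lambda>z. f (fst z) + h (snd z)) (\<lambda>z. z \<in> A \<times> B) w"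
      using a(1) b(1) by (auto simp: is_arg_max_def)
  qed
qed

theorem proposition1:
  fixes g :: "'x \<Rightarrow> 'k::finite \<Rightarrow> 't \<Rightarrow> real"
    and S :: "'t \<Rightarrow> (real ^ 'k) \<times> (real ^ 'k) \<Rightarrow> 'x \<Rightarrow> real ^ 'k"
    and N M :: nat
    and x xu :: "nat \<Rightarrow> 'x"
    and y :: "nat \<Rightarrow> real ^ 'k"
    and \<theta> \<theta>' :: 't
    and \<pi>' :: "(real ^ 'k) \<times> (real ^ 'k)"
  assumes "N \<ge> 1" and "M \<ge> 1"
    and "\<And>z k \<tau>. g z k \<tau> > 0"
    and "\<And>i. i \<in> {1..N} \<Longrightarrow> one_hot (y i)"
    and "\<And>j. j \<in> {1..M} \<Longrightarrow> S \<theta>' \<pi>' (xu j) \<in> prob_simplex"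
  shows "is_arg_max (\<lambda>\<pi>. expected_loglik g S N x y M xu \<theta> \<pi> \<theta>' \<pi>')
           (\<lambda>\<pi>. \<pi> \<in> prob_simplex \<times> prob_simplex) \<pi>hat \<longleftrightarrow>
         \<pi>hat = ((1 / real N) *\<^sub>R (\<Sum>i=1..N. y i),
                 (1 / real M) *\<^sub>R (\<Sum>j=1..M. S \<theta>' \<pi>' (xu j)))"
proof -
  \<comment> \<open>With \<theta> fixed, \<open>g\<close> supplies the positive constants
    \<open>c\<close>, and each labeled term is expanded into a sum over classes weighted by its
    one-hot vector. The two summands then depend on separate components of the prior.\<close>
  have "expected_loglik g S N x y M xu \<theta> \<pi> \<theta>' \<pi>' =
      soft_loglik N y (\<lambda>i k. g (x i) k \<theta>) (fst \<pi>) +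
      soft_loglik M (\<lambda>j. S \<theta>' \<pi>' (xu j)) (\<lambda>j k. g (xu j) k \<theta>) (snd \<pi>)" for \<pi>
    using assms(4)
    by (simp add: expected_loglik_def soft_loglik_def class_posterior_def categorical_def
        one_hot_sum_mult)
  moreover have "\<And>i. i \<in> {1..N} \<Longrightarrow> y i \<in> prob_simplex"
    using assms(4) by (rule one_hot_in_prob_simplex)
  ultimately show ?thesis
    using assms(1-3,5)
    by (simp only:)
      (intro is_arg_max_add_ereal mean_in_prob_simplex soft_loglik_mean_finite
        soft_loglik_less_mean; assumption)
qed

end
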